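(* Let $P=\{p_1,\ldots,p_d\}$ and $Q=\{q_1,\ldots,q_d\}$ be finite partially ordered sets. Then $$\mathrm{vol}(\Gamma(\mathcal{C}(P),-\mathcal{C}(Q)))=\sum_{W\subset[d]}\frac{e(\Delta_W(P,Q))}{d!}.$$
   Context: $[d]=\{1,\ldots,d\}$, $\mathbf{e}_i$ unit coordinate vectors, $\mathrm{vol}$ the usual Euclidean volume in $\mathbb{R}^d$. For $I\subset P$, $\rho(I)=\sum_{p_i\in I}\mathbf{e}_i$ (similarly for $Q$). The chain polytope $\mathcal{C}(P)=\mathrm{conv}\{\rho(A): A\text{ antichain of }P\}$ (antichains include $\emptyset$), and $\Gamma(\mathcal{C}(P),-\mathcal{C}(Q))=\mathrm{conv}(\mathcal{C}(P)\cup(-\mathcal{C}(Q)))$. For $W\subset[d]$, $\overline W=[d]\setminus W$, and $\Delta_W(P,Q)$ is the ordinal sum $P_W\oplus Q_{\overline W}$ of the induced subposets $P_W=\{p_i:i\in W\}$ and $Q_{\overline W}=\{q_j:j\in\overline W\}$ (order of $P$ on $P_W$, of $Q$ on $Q_{\overline W}$, and every element of $P_W$ below every element of $Q_{\overline W}$). Let $R=\{r_1,\dots,r_d\}$ be the poset with $r_i\le r_j$ iff the element of $\Delta_W(P,Q)$ with index $i$ ($p_i$ if $i\in W$, $q_i$ otherwise) is $\le$ the element with index $j$. $e(\Delta_W(P,Q))$ is the number of permutations $i_1\cdots i_d$ of $[d]$ with $a<b$ whenever $r_{i_a}<r_{i_b}$. *)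

theory Defs
  imports "HOL-Analysis.Analysis" "HOL-Combinatorics.Multiset_Permutations"
begin

text \<open>
  The index set $[d]$ is the universe of a finite type \<^typ>\<open>'n\<close>, so that $d$ is
  \<open>CARD('n)\<close> and $R^d$ is \<open>real ^ 'n\<close>.  A labelled poset
  $\{p_1, \ldots, p_d\}$ is given by its reflexive order transported to the indices:
  \<open>P :: 'n rel\<close> with \<open>partial_order_on UNIV P\<close>, where \<open>(i, j) \<in> P\<close> means
  $p_i \leq p_j$.
\<close>

definition indicator_vec :: "'n::finite set \<Rightarrow> real ^ 'n" where
  "indicator_vec I = (\<Sum>i\<in>I. axis i 1)"

definition antichain :: "'a rel \<Rightarrow> 'a set \<Rightarrow> bool" where
  "antichain r A \<longleftrightarrow> (\<forall>x\<in>A. \<forall>y\<in>A. (x, y) \<in> r \<longrightarrow> x = y)"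

definition chain_polytope :: "'n::finite rel \<Rightarrow> (real ^ 'n) set" where
  "chain_polytope P = convex hull {indicator_vec A | A. antichain P A}"

definition Gamma_polytope :: "(real ^ 'n) set \<Rightarrow> (real ^ 'n) set \<Rightarrow> (real ^ 'n) set" where
  "Gamma_polytope K L = convex hull (K \<union> L)"

definition induced_order :: "'a rel \<Rightarrow> 'a set \<Rightarrow> 'a rel" where
  "induced_order r A = r \<inter> A \<times> A"

text \<open>Ordinal sum of posets \<open>(A, r)\<close> and \<open>(B, s)\<close>, for disjoint carriers \<open>A\<close> and \<open>B\<close>.\<close>

definition ordinal_sum :: "'a set \<Rightarrow> 'a rel \<Rightarrow> 'a set \<Rightarrow> 'a rel \<Rightarrow> 'a rel" where
  "ordinal_sum A r B s = r \<union> s \<union> A \<times> B"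

text \<open>
  The elements of $P_W$ and $Q_{\overline W}$ carry disjoint sets of indices which together
  exhaust $[d]$; identifying each element with its index, \<open>Delta\<close> is directly the order of
  the relabelled poset $R = \{r_1, \ldots, r_d\}$.
\<close>

definition Delta :: "'n set \<Rightarrow> 'n rel \<Rightarrow> 'n rel \<Rightarrow> 'n rel" where
  "Delta W P Q = ordinal_sum W (induced_order P W) (- W) (induced_order Q (- W))"

text \<open>
  Number of linear extensions of a poset on the index set.  A permutation $i_1 \cdots i_d$ is
  the list of its entries, with positions counted from 0.
\<close>

definition num_linear_extensions :: "'n::finite rel \<Rightarrow> nat" where
  "num_linear_extensions R =
    card {xs \<in> permutations_of_set UNIV.
      \<forall>a<length xs. \<forall>b<length xs. (xs ! a, xs ! b) \<in> R \<and> xs ! a \<noteq> xs ! b \<longrightarrow> a < b}"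

end

theory Submission
  imports Defs
begin

text \<open>
  By Stanley's description of chain polytopes by chain inequalities, a point \<open>x\<close> lies in
  $\Gamma(\mathcal{C}(P), -\mathcal{C}(Q))$ iff the heaviest chain of $P$ for the positive part
  of \<open>x\<close> and the heaviest chain of $Q$ for the negative part of \<open>x\<close> weigh at most 1 together.
  Since chains of an ordinal sum are unions of chains of the summands, the part of this body
  in the orthant where exactly the coordinates in $W$ are nonnegative is a reflected copy of the
  chain polytope of $\Delta_W(P, Q)$.  Stanley's transfer map, a composition of piecewise
  linear shears, carries the order polytope onto the chain polytope and preserves volume; the
  order polytope is cut by the hyperplanes $x_i = x_j$ into one simplex of volume $1/d!$ per
  linear extension.
\<close>

section \<open>Volume-preserving maps\<close>

text \<open>Stated for images, with measurability of the image included, so that the property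
  composes without side conditions.\<close>

definition volume_preserving :: "(real ^ 'n \<Rightarrow> real ^ 'n) \<Rightarrow> bool" where
  "volume_preserving f \<longleftrightarrow>
    (\<forall>S\<in>lmeasurable. f ` S \<in> lmeasurable \<and> measure lebesgue (f ` S) = measure lebesgue S)"

lemma volume_preserving_id: "volume_preserving (\<lambda>x. x)"
  by (simp add: volume_preserving_def)

lemma volume_preserving_comp:
  assumes "volume_preserving f" "volume_preserving g"
  shows "volume_preserving (\<lambda>x. f (g x))"
proof -
  have "(\<lambda>x. f (g x)) ` S = f ` g ` S" for S
    by (simp add: image_image)
  with assms show ?thesis
    by (simp add: volume_preserving_def)
qed

text \<open>The pieces may overlap: induction on \<open>J\<close> cuts off
  \<open>S \<inter> A j\<close>, where \<open>f\<close> agrees with \<open>g j\<close>, and treats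
  only the rest by the remaining pieces. Injectivity keeps the images of the two disjoint parts
  disjoint, so their measures add up.\<close>

lemma volume_preserving_piecewise:
  fixes f :: "real ^ 'n \<Rightarrow> real ^ 'n"
  assumes "finite J" and "inj f"
    and A: "\<And>j. j \<in> J \<Longrightarrow> A j \<in> sets lebesgue"
    and g: "\<And>j. j \<in> J \<Longrightarrow> volume_preserving (g j)"
    and eq: "\<And>j x. j \<in> J \<Longrightarrow> x \<in> A j \<Longrightarrow> f x = g j x"
    and cover: "(\<Union>j\<in>J. A j) = UNIV"
  shows "volume_preserving f"
proof -
  \<comment> \<open>The covering of the whole space is not inherited by smaller index sets;
    requiring only \<open>S\<close> to be covered makes the induction possible.\<close>
  have "f ` S \<in> lmeasurable \<and> measure lebesgue (f ` S) = measure lebesgue S"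
    if "S \<in> lmeasurable" "S \<subseteq> (\<Union>j\<in>J. A j)" for S
    using \<open>finite J\<close> that A g eq
  proof (induction J arbitrary: S rule: finite_induct)
    case empty
    then show ?case by simp
  next
    case (insert j J)
    let ?S1 = "S \<inter> A j" and ?S2 = "S - A j"
    have m1: "?S1 \<in> lmeasurable" and m2: "?S2 \<in> lmeasurable"
      using insert.prems(1,3) by (auto intro: fmeasurable_Int_fmeasurable fmeasurable_Diff)
    have "f ` ?S1 = g j ` ?S1"
      by (intro image_cong) (use insert.prems(5) in auto)
    then have f1: "f ` ?S1 \<in> lmeasurable" "measure lebesgue (f ` ?S1) = measure lebesgue ?S1"
      using insert.prems(4) m1 by (auto simp: volume_preserving_def)
    have f2: "f ` ?S2 \<in> lmeasurable \<and> measure lebesgue (f ` ?S2) = measure lebesgue ?S2"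
      using insert.prems m2 by (intro insert.IH) auto
    have fS: "f ` S = f ` ?S1 \<union> f ` ?S2" by auto
    have "f ` ?S1 \<inter> f ` ?S2 = {}"
      using \<open>inj f\<close> by (auto dest: injD)
    then have "measure lebesgue (f ` S) = measure lebesgue (f ` ?S1) + measure lebesgue (f ` ?S2)"
      unfolding fS using f1 f2 by (intro measure_Un_AE) (auto intro!: AE_I2)
    also have "\<dots> = measure lebesgue ?S1 + measure lebesgue ?S2"
      using f1 f2 by simp
    also have "\<dots> = measure lebesgue (?S1 \<union> ?S2)"
      using m1 m2 by (intro measure_Un_AE [symmetric]) (auto intro!: AE_I2)
    also have "?S1 \<union> ?S2 = S" by auto
    finally show ?case
      using f1 f2 fS by (simp add: fmeasurable.Un)
  qed
  then show ?thesis
    using cover by (auto simp: volume_preserving_def)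
qed

section \<open>Reflections, coordinate permutations and shears\<close>

lemma volume_preserving_reflection:
  "volume_preserving (\<lambda>x :: real ^ 'n. \<chi> i. if i \<in> W then x $ i else - x $ i)"
proof -
  define m :: "'n \<Rightarrow> real" where "m i = (if i \<in> W then 1 else -1)" for i
  have eq: "(\<lambda>x :: real ^ 'n. \<chi> i. if i \<in> W then x $ i else - x $ i) = (\<lambda>x. \<chi> i. m i * x $ i)"
    by (auto simp: m_def vec_eq_iff)
  \<comment> \<open>The reflection is a coordinatewise stretch, whose volume factor is the absolute
    value of this product.\<close>
  have "\<bar>prod m UNIV\<bar> = 1"
    by (simp add: abs_prod m_def if_distrib [of abs] cong: if_cong)
  then show ?thesis
    unfolding eq volume_preserving_def by (simp add: measurable_stretch measure_stretch)
qed

text \<open>For a linear map it suffices to check boxes, and a box goes to the box whose sides are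
  permuted.\<close>

lemma volume_preserving_permute:
  fixes p :: "'n::finite \<Rightarrow> 'n"
  assumes "bij p"
  shows "volume_preserving (\<lambda>x :: real ^ 'n. \<chi> i. x $ p i)" (is "volume_preserving ?h")
proof -
  have lin: "linear ?h"
    by (rule linearI) (simp_all add: plus_vec_def scaleR_vec_def)
  have "measure lebesgue (?h ` cbox a b) = 1 * measure lebesgue (cbox a b)" for a b
  proof (cases "cbox a b = {}")
    case False
    have eq: "?h ` cbox a b = cbox (?h a) (?h b)"
    proof (intro equalityI subsetI)
      fix y assume y: "y \<in> cbox (?h a) (?h b)"
      have "y = ?h (\<chi> i. y $ inv p i)"
        using assms by (simp add: vec_eq_iff bij_is_inj)
      moreover have "a $ i \<le> y $ inv p i \<and> y $ inv p i \<le> b $ i" for i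
        using y [unfolded mem_box_cart, rule_format, of "inv p i"] assms
        by (simp add: bij_is_surj surj_f_inv_f)
      then have "(\<chi> i. y $ inv p i) \<in> cbox a b"
        by (simp add: mem_box_cart)
      ultimately show "y \<in> ?h ` cbox a b" by blast
    qed (auto simp: mem_box_cart)
    with False have "cbox (?h a) (?h b) \<noteq> {}" by auto
    then have "measure lebesgue (?h ` cbox a b) = (\<Prod>i\<in>UNIV. b $ p i - a $ p i)"
      unfolding eq by (simp add: content_cbox_cart)
    also have "\<dots> = (\<Prod>i\<in>UNIV. b $ i - a $ i)"
      by (rule prod.reindex_bij_betw [OF assms])
    also have "\<dots> = 1 * measure lebesgue (cbox a b)"
      using False by (simp add: content_cbox_cart)
    finally show ?thesis .
  qed simp
  then have "?h ` S \<in> lmeasurable \<and> measure lebesgue (?h ` S) = measure lebesgue S"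
    if "S \<in> lmeasurable" for S
    using measure_linear_sufficient [OF lin that, of 1] by simp
  then show ?thesis
    by (simp add: volume_preserving_def)
qed

lemma volume_preserving_add_coordinate:
  fixes m n :: "'n::finite"
  assumes "m \<noteq> n"
  shows "volume_preserving (\<lambda>x :: real ^ 'n. \<chi> i. if i = m then x $ m + x $ n else x $ i)"
    (is "volume_preserving ?h")
proof -
  have lin: "linear ?h"
    by (rule linearI) (auto simp: algebra_simps plus_vec_def scaleR_vec_def vec_eq_iff)
  have "measure lebesgue (?h ` cbox a b) = 1 * measure lebesgue (cbox a b)" for a b
  proof (cases "cbox a b = {}")
    case False
    \<comment> \<open>\<open>measure_shear_interval\<close> needs a lower corner with nonnegative
      coordinate \<open>n\<close>; translation by \<open>?v\<close> makes that coordinate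
      zero.\<close>
    let ?v = "axis n (- (a $ n))"
    have "?h ` (+) ?v ` cbox a b = (+) (?h ?v) ` ?h ` cbox a b"
      by (simp add: image_image linear_add [OF lin])
    then have "measure lebesgue (?h ` cbox a b) = measure lebesgue (?h ` (+) ?v ` cbox a b)"
      by (simp only: measure_translation)
    also have "\<dots> = measure lebesgue (?h ` cbox (?v + a) (?v + b))"
      by (simp only: cbox_translation)
    also have "\<dots> = measure lebesgue (cbox (?v + a) (?v + b))"
    proof (rule measure_shear_interval)
      show "cbox (?v + a) (?v + b) \<noteq> {}"
        using False by (simp only: cbox_translation) auto
    qed (use assms in auto)
    also have "\<dots> = measure lebesgue (cbox a b)"
      by (simp only: cbox_translation measure_translation)
    finally show ?thesis by simp
  qed simp
  then have "?h ` S \<in> lmeasurable \<and> measure lebesgue (?h ` S) = measure lebesgue S"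
    if "S \<in> lmeasurable" for S
    using measure_linear_sufficient [OF lin that, of 1] by simp
  then show ?thesis
    by (simp add: volume_preserving_def)
qed

text \<open>Conjugating the adding shear by the reflection of coordinate \<open>n\<close> turns the
  addition into a subtraction.\<close>

lemma volume_preserving_diff_coordinate:
  fixes m n :: "'n::finite"
  assumes "m \<noteq> n"
  shows "volume_preserving (\<lambda>x :: real ^ 'n. \<chi> i. if i = m then x $ m - x $ n else x $ i)"
proof -
  let ?r = "\<lambda>x :: real ^ 'n. \<chi> i. if i \<in> - {n} then x $ i else - x $ i"
  let ?h = "\<lambda>x :: real ^ 'n. \<chi> i. if i = m then x $ m + x $ n else x $ i"
  have "volume_preserving (\<lambda>x. ?r (?h (?r x)))"
    by (rule volume_preserving_comp [of ?r, OF volume_preserving_reflection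
          volume_preserving_comp [of ?h ?r, OF volume_preserving_add_coordinate [OF assms]
            volume_preserving_reflection]])
  also have "(\<lambda>x. ?r (?h (?r x))) = (\<lambda>x. \<chi> i. if i = m then x $ m - x $ n else x $ i)"
    using assms by (auto simp: vec_eq_iff)
  finally show ?thesis .
qed

section \<open>Finite posets and their chains\<close>

text \<open>A minimal element among the members of \<open>S\<close> below \<open>c\<close> is
  minimal in all of \<open>S\<close>: by transitivity, any member of \<open>S\<close> below it is
  also below \<open>c\<close>.\<close>

lemma exists_minimal_below:
  fixes R :: "'a::finite rel"
  assumes po: "partial_order_on UNIV R" and "c \<in> S"
  shows "\<exists>m\<in>S. (m, c) \<in> R \<and> (\<forall>b\<in>S. (b, m) \<in> R \<longrightarrow> b = m)"
proof -
  have wf: "wf (R - Id)"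
    using po by (intro finite_acyclic_wf) (auto intro: partial_order_on_acyclic)
  have "c \<in> {b \<in> S. (b, c) \<in> R}"
    using po \<open>c \<in> S\<close> by (auto simp: order_on_defs refl_on_def)
  then obtain m where m: "m \<in> S" "(m, c) \<in> R"
    and min: "\<And>b. (b, m) \<in> R - Id \<Longrightarrow> b \<notin> {b \<in> S. (b, c) \<in> R}"
    using wfE_min [OF wf] by (metis (no_types, lifting) mem_Collect_eq)
  have "b = m" if "b \<in> S" "(b, m) \<in> R" for b
    using min [of b] that m po by (auto simp: order_on_defs dest: transD)
  with m show ?thesis by blast
qed

lemma chain_has_least:
  fixes R :: "'a::finite rel"
  assumes po: "partial_order_on UNIV R" and C: "C \<in> Chains R" "C \<noteq> {}"
  obtains m where "m \<in> C" "\<And>c. c \<in> C \<Longrightarrow> (m, c) \<in> R"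
proof -
  from C obtain c where "c \<in> C" by auto
  from exists_minimal_below [OF po this] obtain m
    where "m \<in> C" "\<forall>b\<in>C. (b, m) \<in> R \<longrightarrow> b = m" by blast
  with C(1) that show ?thesis
    unfolding Chains_def by blast
qed

lemma chain_has_greatest:
  fixes R :: "'a::finite rel"
  assumes po: "partial_order_on UNIV R" and C: "C \<in> Chains R" "C \<noteq> {}"
  obtains m where "m \<in> C" "\<And>c. c \<in> C \<Longrightarrow> (c, m) \<in> R"
proof -
  have "partial_order_on UNIV (R\<inverse>)" "C \<in> Chains (R\<inverse>)"
    using po C by (auto simp: Chains_def)
  from chain_has_least [OF this C(2)] that show ?thesis by auto
qed

section \<open>Volume of order polytopes\<close>

text \<open>Strict inequalities make the simplices of different permutations disjoint, at the price
  of covering an order polytope only up to a null set.\<close>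

definition strict_order_simplex :: "'n list \<Rightarrow> (real ^ 'n) set" where
  "strict_order_simplex xs =
    {x. (\<forall>i. 0 \<le> x $ i \<and> x $ i \<le> 1) \<and> sorted_wrt (<) (map (($) x) xs)}"

definition order_polytope :: "'n rel \<Rightarrow> (real ^ 'n) set" where
  "order_polytope R =
    {x. (\<forall>i. 0 \<le> x $ i \<and> x $ i \<le> 1) \<and> (\<forall>(i, j)\<in>R. x $ i \<le> x $ j)}"

lemma lmeasurable_order_polytope:
  fixes R :: "'n::finite rel"
  shows "order_polytope R \<in> lmeasurable"
proof (rule lmeasurable_compact)
  have "order_polytope R = cbox 0 (\<chi> i. 1) \<inter> (\<Inter>(i, j)\<in>R. {x. x $ i \<le> x $ j})"
    by (auto simp: order_polytope_def mem_box_cart)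
  also have "compact \<dots>"
    by (intro compact_Int_closed compact_cbox closed_INT ballI)
      (auto intro!: closed_Collect_le continuous_intros)
  finally show "compact (order_polytope R)" .
qed

lemma lmeasurable_strict_order_simplex:
  fixes xs :: "'n::finite list"
  shows "strict_order_simplex xs \<in> lmeasurable"
proof -
  have eq: "strict_order_simplex xs = cbox 0 (\<chi> i. 1) \<inter>
    (\<Inter>j\<in>{..<length xs}. \<Inter>i\<in>{..<j}. {x. x $ (xs ! i) < x $ (xs ! j)})"
    by (auto simp: strict_order_simplex_def mem_box_cart sorted_wrt_iff_nth_less)
  have "open (\<Inter>j\<in>{..<length xs}. \<Inter>i\<in>{..<j}. {x :: real ^ 'n. x $ (xs ! i) < x $ (xs ! j)})"
    by (intro open_INT ballI) (auto intro!: open_Collect_less continuous_intros)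
  then show ?thesis
    unfolding eq by (intro fmeasurable_Int_fmeasurable) auto
qed

lemma strict_order_simplex_disjoint:
  assumes "set xs = set ys" "x \<in> strict_order_simplex xs" "x \<in> strict_order_simplex ys"
  shows "xs = ys"
proof (rule map_sorted_distinct_set_unique [of "($) x"])
  have *: "sorted_wrt (<) (map (($) x) xs)" "sorted_wrt (<) (map (($) x) ys)"
    using assms by (auto simp: strict_order_simplex_def)
  then show "sorted (map (($) x) xs)" "distinct (map (($) x) xs)"
    "sorted (map (($) x) ys)" "distinct (map (($) x) ys)"
    by (simp_all add: strict_sorted_iff)
  then show "inj_on (($) x) (set xs \<union> set ys)"
    using assms(1) by (simp add: distinct_map)
qed (fact assms(1))

text \<open>The permutation of indices taking \<open>ys\<close> to \<open>xs\<close> entry by entry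
  induces a coordinate permutation that carries one simplex onto the other.\<close>

lemma measure_strict_order_simplex_cong:
  fixes xs ys :: "'n::finite list"
  assumes "xs \<in> permutations_of_set UNIV" "ys \<in> permutations_of_set UNIV"
  shows "measure lebesgue (strict_order_simplex xs) = measure lebesgue (strict_order_simplex ys)"
proof -
  have xs: "set xs = UNIV" "distinct xs" and ys: "set ys = UNIV" "distinct ys"
    using assms by (auto dest: permutations_of_setD)
  have len: "length xs = length ys"
    using assms by (simp add: length_finite_permutations_of_set)
  have bx: "bij_betw ((!) xs) {..<length xs} UNIV" and "bij_betw ((!) ys) {..<length xs} UNIV"
    using bij_betw_nth [OF xs(2)] bij_betw_nth [OF ys(2)] xs(1) ys(1) len by auto
  then have by': "bij_betw (the_inv_into {..<length xs} ((!) ys)) UNIV {..<length xs}"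
    by (simp add: bij_betw_the_inv_into)
  define p where "p = (!) xs \<circ> the_inv_into {..<length xs} ((!) ys)"
  have p: "bij p"
    unfolding p_def by (rule bij_betw_trans [OF by' bx])
  have "p (ys ! k) = xs ! k" if "k < length xs" for k
    using that ys(2) len by (simp add: p_def the_inv_into_f_f inj_on_nth)
  then have map: "map p ys = xs"
    using len by (intro nth_equalityI) auto
  let ?h = "\<lambda>x :: real ^ 'n. \<chi> i. x $ p i"
  have "?h ` strict_order_simplex xs = strict_order_simplex ys"
  proof (intro equalityI subsetI)
    fix y assume y: "y \<in> strict_order_simplex ys"
    have inv: "y $ inv p (p i) = y $ i" for i
      using p by (simp add: bij_is_inj)
    then have "y = ?h (\<chi> i. y $ inv p i)"
      by (simp add: vec_eq_iff)
    moreover have "(\<chi> i. y $ inv p i) \<in> strict_order_simplex xs"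
      using y inv by (auto simp: strict_order_simplex_def sorted_wrt_map simp flip: map)
    ultimately show "y \<in> ?h ` strict_order_simplex xs" by blast
  qed (auto simp: strict_order_simplex_def sorted_wrt_map simp flip: map)
  then show ?thesis
    using volume_preserving_permute [OF p] lmeasurable_strict_order_simplex [of xs]
    unfolding volume_preserving_def by metis
qed

text \<open>Off the null set \<open>?N\<close> of points with two equal coordinates, sorting the
  indices by coordinate value yields a linear extension whose simplex contains the point. All
  simplices have the volume of the one for \<open>xs0\<close>, which stays an unknown factor
  here.\<close>

lemma measure_order_polytope_sum:
  fixes R :: "'n::finite rel" and xs0 :: "'n list"
  assumes "xs0 \<in> permutations_of_set UNIV"
  shows "measure lebesgue (order_polytope R) =
    real (num_linear_extensions R) * measure lebesgue (strict_order_simplex xs0)"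
proof -
  let ?E = "{xs \<in> permutations_of_set UNIV.
      \<forall>a<length xs. \<forall>b<length xs. (xs ! a, xs ! b) \<in> R \<and> xs ! a \<noteq> xs ! b \<longrightarrow> a < b}"
  let ?N = "\<Union>i. \<Union>j\<in>- {i}. {x :: real ^ 'n. (axis i 1 - axis j 1) \<bullet> x = 0}"
  have "negligible {x :: real ^ 'n. (axis i 1 - axis j 1) \<bullet> x = 0}" if "j \<noteq> i" for i j
  proof (rule negligible_hyperplane)
    show "axis i 1 - axis j 1 \<noteq> (0 :: real ^ 'n) \<or> (0::real) \<noteq> 0"
      using that by (simp add: axis_eq_axis)
  qed
  then have negN: "negligible ?N"
    by (auto intro!: negligible_Union)
  have sub: "order_polytope R - ?N \<subseteq> (\<Union>xs\<in>?E. strict_order_simplex xs)"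
  proof
    fix x assume x: "x \<in> order_polytope R - ?N"
    have inj: "i = j" if "x $ i = x $ j" for i j
      using x that by (auto simp: inner_diff_left inner_axis')
    define xs where "xs = sort_key (($) x) xs0"
    have xs: "xs \<in> permutations_of_set UNIV"
      using assms by (auto simp: xs_def permutations_of_set_def)
    have sorted: "sorted (map (($) x) xs)"
      by (simp add: xs_def)
    moreover have "inj_on (($) x) (set xs)"
      by (intro inj_onI inj)
    then have "distinct (map (($) x) xs)"
      using xs by (simp add: distinct_map permutations_of_set_def)
    ultimately have strict: "sorted_wrt (<) (map (($) x) xs)"
      by (simp add: strict_sorted_iff)
    have "a < b" if ab: "a < length xs" "b < length xs"
      and "(xs ! a, xs ! b) \<in> R" "xs ! a \<noteq> xs ! b" for a b
    proof (rule ccontr)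
      assume "\<not> a < b"
      with ab have "x $ (xs ! b) \<le> x $ (xs ! a)"
        using sorted_nth_mono [OF sorted, of b a] by simp
      moreover have "x $ (xs ! a) \<le> x $ (xs ! b)"
        using x that(3) by (auto simp: order_polytope_def)
      ultimately have "xs ! a = xs ! b"
        by (intro inj antisym)
      with that(4) show False ..
    qed
    with xs strict x show "x \<in> (\<Union>xs\<in>?E. strict_order_simplex xs)"
      by (auto simp: strict_order_simplex_def order_polytope_def)
  qed
  have sup: "strict_order_simplex xs \<subseteq> order_polytope R" if xs: "xs \<in> ?E" for xs
  proof
    fix x assume x: "x \<in> strict_order_simplex xs"
    have "x $ i \<le> x $ j" if "(i, j) \<in> R" for i j
    proof (cases "i = j")
      case False
      have "i \<in> set xs" "j \<in> set xs"
        using xs by (auto simp: permutations_of_set_def)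
      then obtain a b where "a < length xs" "b < length xs" "xs ! a = i" "xs ! b = j"
        by (metis in_set_conv_nth)
      with False xs x that show ?thesis
        by (auto simp: strict_order_simplex_def sorted_wrt_iff_nth_less intro: less_imp_le)
    qed simp
    with x show "x \<in> order_polytope R"
      by (auto simp: strict_order_simplex_def order_polytope_def)
  qed
  have "measure lebesgue (order_polytope R) =
      measure lebesgue (\<Union>xs\<in>?E. strict_order_simplex xs)"
  proof (rule measure_negligible_symdiff)
    show "(\<Union>xs\<in>?E. strict_order_simplex xs) \<in> lmeasurable"
      by (intro fmeasurable.finite_UN lmeasurable_strict_order_simplex) auto
    show "negligible ((\<Union>xs\<in>?E. strict_order_simplex xs) - order_polytope R \<union>
        (order_polytope R - (\<Union>xs\<in>?E. strict_order_simplex xs)))"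
    proof (rule negligible_subset [OF negN])
      have *: "S - T \<union> (T - S) \<subseteq> N" if "T - N \<subseteq> S" "S \<subseteq> T" for S T N :: "(real ^ 'n) set"
        using that by blast
      show "(\<Union>xs\<in>?E. strict_order_simplex xs) - order_polytope R \<union>
          (order_polytope R - (\<Union>xs\<in>?E. strict_order_simplex xs)) \<subseteq> ?N"
        by (rule * [OF sub UN_least [OF sup]])
    qed
  qed
  also have "\<dots> = (\<Sum>xs\<in>?E. measure lebesgue (strict_order_simplex xs))"
  proof (rule measure_UNION')
    show "pairwise (\<lambda>xs ys. disjnt (strict_order_simplex xs) (strict_order_simplex ys)) ?E"
    proof (rule pairwiseI)
      fix xs ys assume "xs \<in> ?E" "ys \<in> ?E" and "xs \<noteq> ys"
      then have "set xs = set ys"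
        by (auto dest: permutations_of_setD)
      with \<open>xs \<noteq> ys\<close> show "disjnt (strict_order_simplex xs) (strict_order_simplex ys)"
        unfolding disjnt_iff using strict_order_simplex_disjoint by blast
    qed
  qed (auto intro: lmeasurable_strict_order_simplex)
  also have "\<dots> = (\<Sum>xs\<in>?E. measure lebesgue (strict_order_simplex xs0))"
    by (intro sum.cong measure_strict_order_simplex_cong assms refl) auto
  finally show ?thesis
    by (simp add: num_linear_extensions_def)
qed

text \<open>The unknown simplex volume is found from the empty relation: its order polytope is the
  unit cube, and every permutation is a linear extension of it.\<close>

lemma measure_order_polytope:
  fixes R :: "'n::finite rel"
  shows "measure lebesgue (order_polytope R) = real (num_linear_extensions R) / fact CARD('n)"
proof -
  obtain xs0 :: "'n list" where xs0: "xs0 \<in> permutations_of_set UNIV"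
    using permutations_of_set_empty_iff [of "UNIV :: 'n set"] finite by blast
  have "order_polytope ({} :: 'n rel) = cbox 0 (\<chi> i. 1)"
    by (auto simp: order_polytope_def mem_box_cart)
  then have "measure lebesgue (order_polytope ({} :: 'n rel)) = 1"
    by (simp add: content_cbox_if_cart interval_ne_empty_cart)
  moreover have "num_linear_extensions ({} :: 'n rel) = fact CARD('n)"
    by (simp add: num_linear_extensions_def)
  ultimately have "fact CARD('n) * measure lebesgue (strict_order_simplex xs0) = 1"
    using measure_order_polytope_sum [OF xs0, of "{}"] by simp
  then have "measure lebesgue (strict_order_simplex xs0) = 1 / fact CARD('n)"
    by (simp add: field_simps)
  with measure_order_polytope_sum [OF xs0, of R] show ?thesis
    by simp
qed

section \<open>The transfer map\<close>

text \<open>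
  The value \<open>0\<close> at \<open>j = i\<close> keeps the maximum meaningful when nothing lies strictly below \<open>i\<close>.
\<close>

definition lower_max :: "'n::finite rel \<Rightarrow> real ^ 'n \<Rightarrow> 'n \<Rightarrow> real" where
  "lower_max R x i = (MAX j\<in>{j. (j, i) \<in> R}. if j = i then 0 else x $ j)"

text \<open>Stanley's transfer map is the case \<open>U = UNIV\<close>. The other \<open>U\<close>
  are intermediate stages; \<open>lower_max\<close> is always taken at the original point.\<close>

definition partial_transfer :: "'n::finite rel \<Rightarrow> 'n set \<Rightarrow> real ^ 'n \<Rightarrow> real ^ 'n" where
  "partial_transfer R U x = (\<chi> i. if i \<in> U then x $ i - lower_max R x i else x $ i)"

text \<open>Stanley's chain inequalities. The bound \<open>1\<close> is the one used for volumes; a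
  general \<open>h\<close> is needed when multiples of antichain vectors are split off.\<close>

definition chain_region :: "'n::finite rel \<Rightarrow> real \<Rightarrow> (real ^ 'n) set" where
  "chain_region R h = {y. (\<forall>i. 0 \<le> y $ i) \<and> (\<forall>C\<in>Chains R. (\<Sum>i\<in>C. y $ i) \<le> h)}"

lemma lower_max_cong:
  assumes "\<And>j. (j, i) \<in> R \<Longrightarrow> j \<noteq> i \<Longrightarrow> x $ j = y $ j"
  shows "lower_max R x i = lower_max R y i"
  unfolding lower_max_def
  by (intro arg_cong [of _ _ Max] image_cong) (use assms in auto)

lemma lower_max_eqI:
  assumes "refl R" and "0 \<le> v" and "\<And>j. (j, i) \<in> R \<Longrightarrow> j \<noteq> i \<Longrightarrow> x $ j \<le> v"
    and "v = 0 \<or> (\<exists>j. (j, i) \<in> R \<and> j \<noteq> i \<and> x $ j = v)"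
  shows "lower_max R x i = v"
  unfolding lower_max_def
proof (rule Max_eqI)
  show "v \<in> (\<lambda>j. if j = i then 0 else x $ j) ` {j. (j, i) \<in> R}"
    using assms(4)
  proof (elim disjE exE conjE)
    assume "v = 0"
    then show ?thesis
      using assms(1) by (intro image_eqI [of _ _ i]) (auto simp: refl_on_def)
  next
    fix j assume "(j, i) \<in> R" "j \<noteq> i" "x $ j = v"
    then show ?thesis
      by (intro image_eqI [of _ _ j]) auto
  qed
qed (use assms in auto)

lemma lower_max_nonneg:
  assumes "refl R"
  shows "0 \<le> lower_max R x i"
  unfolding lower_max_def
  by (rule Max_ge) (use assms in \<open>auto simp: refl_on_def image_iff intro!: exI [of _ i]\<close>)

lemma le_lower_max:
  assumes "(j, i) \<in> R" "j \<noteq> i"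
  shows "x $ j \<le> lower_max R x i"
  unfolding lower_max_def
  by (rule Max_ge) (use assms in \<open>auto simp: image_iff intro!: exI [of _ j]\<close>)

lemma lower_max_le:
  assumes "refl R" and "0 \<le> v" and "\<And>j. (j, i) \<in> R \<Longrightarrow> j \<noteq> i \<Longrightarrow> x $ j \<le> v"
  shows "lower_max R x i \<le> v"
proof -
  have "{j. (j, i) \<in> R} \<noteq> {}"
    using assms(1) by (auto simp: refl_on_def)
  then show ?thesis
    unfolding lower_max_def using assms by (intro Max.boundedI) auto
qed

text \<open>Where the maximum is attained at \<open>j\<close>, the map is the identity
  (\<open>j = i\<close>) or subtracts coordinate \<open>j\<close> from coordinate \<open>i\<close>.
  These finitely many closed pieces cover the space, and injectivity holds because
  \<open>lower_max R x i\<close> ignores coordinate \<open>i\<close>.\<close>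

lemma volume_preserving_partial_transfer_single:
  fixes R :: "'n::finite rel"
  assumes "refl R"
  shows "volume_preserving (partial_transfer R {i})"
proof -
  let ?J = "{j. (j, i) \<in> R}"
  let ?v = "\<lambda>j x :: real ^ 'n. if j = i then 0 else x $ j"
  let ?A = "\<lambda>j. \<Inter>k\<in>?J. {x. ?v k x \<le> ?v j x}"
  let ?g = "\<lambda>j x. if j = i then x else \<chi> k. if k = i then x $ i - x $ j else x $ k"
  have J: "?J \<noteq> {}"
    using assms by (auto simp: refl_on_def)
  have max: "lower_max R x i = ?v j x" if "j \<in> ?J" "x \<in> ?A j" for j x
    unfolding lower_max_def using that by (intro Max_eqI) auto
  show ?thesis
  proof (rule volume_preserving_piecewise [of ?J _ ?A ?g])
    show "inj (partial_transfer R {i})"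
    proof (rule injI)
      fix x y assume eq: "partial_transfer R {i} x = partial_transfer R {i} y"
      have other: "x $ j = y $ j" if "j \<noteq> i" for j
        using arg_cong [OF eq, of "\<lambda>z. z $ j"] that by (simp add: partial_transfer_def)
      then have "lower_max R x i = lower_max R y i"
        by (intro lower_max_cong)
      then have "x $ i = y $ i"
        using arg_cong [OF eq, of "\<lambda>z. z $ i"] by (simp add: partial_transfer_def)
      with other show "x = y"
        by (metis vec_eq_iff)
    qed
    show "?A j \<in> sets lebesgue" for j
    proof -
      have "continuous_on UNIV (?v k)" for k
        by (cases "k = i") (auto intro!: continuous_intros)
      then have "closed (?A j)"
        by (intro closed_INT ballI closed_Collect_le)
      then show ?thesis by simp
    qed
    show "volume_preserving (?g j)" for j
      by (cases "j = i") (auto intro: volume_preserving_id volume_preserving_diff_coordinate)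
    show "partial_transfer R {i} x = ?g j x" if "j \<in> ?J" "x \<in> ?A j" for j x
      unfolding partial_transfer_def using max [OF that] by (auto simp: vec_eq_iff)
    show "(\<Union>j\<in>?J. ?A j) = UNIV"
    proof (intro equalityI subsetI)
      fix x :: "real ^ 'n"
      have "Max ((\<lambda>j. ?v j x) ` ?J) \<in> (\<lambda>j. ?v j x) ` ?J"
        using J by (intro Max_in) auto
      then obtain j where j: "j \<in> ?J" "Max ((\<lambda>j. ?v j x) ` ?J) = ?v j x"
        by (rule imageE) simp
      have "?v k x \<le> ?v j x" if "k \<in> ?J" for k
        unfolding j(2) [symmetric] using that by (intro Max_ge) auto
      then have "x \<in> ?A j" by auto
      with j(1) show "x \<in> (\<Union>j\<in>?J. ?A j)" by blast
    qed auto
  qed auto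
qed

text \<open>
  The coordinates in \<open>U\<close> can be transferred one at a time from the top down, because
  \<open>lower_max\<close> at a minimal element of \<open>U\<close> only sees coordinates that have not been changed yet.
\<close>

lemma volume_preserving_partial_transfer:
  fixes R :: "'n::finite rel"
  assumes po: "partial_order_on UNIV R"
    and up: "\<And>i j. i \<in> U \<Longrightarrow> (i, j) \<in> R \<Longrightarrow> j \<in> U"
  shows "volume_preserving (partial_transfer R U)"
proof -
  have "finite U" by simp
  then show ?thesis
    using up
  proof (induction U rule: finite_psubset_induct)
    case (psubset U)
    show ?case
    proof (cases "U = {}")
      case True
      then show ?thesis
        by (simp add: partial_transfer_def volume_preserving_id)
    next
      case False
      then obtain m where m: "m \<in> U" and min: "\<And>b. b \<in> U \<Longrightarrow> (b, m) \<in> R \<Longrightarrow> b = m"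
        using exists_minimal_below [OF po] by (metis ex_in_conv)
      \<comment> \<open>\<open>U - {m}\<close> is still closed upwards, since by minimality no other
        element of \<open>U\<close> lies below \<open>m\<close>.\<close>
      have IH: "volume_preserving (partial_transfer R (U - {m}))"
        using m min psubset.prems by (intro psubset.IH) auto
      have "partial_transfer R {m} (partial_transfer R (U - {m}) x) = partial_transfer R U x" for x
      proof -
        have "lower_max R (partial_transfer R (U - {m}) x) m = lower_max R x m"
          by (rule lower_max_cong) (use min in \<open>auto simp: partial_transfer_def\<close>)
        with m show ?thesis
          unfolding partial_transfer_def [of R "{m}"] partial_transfer_def [of R U]
          by (auto simp: vec_eq_iff) (auto simp: partial_transfer_def)
      qed
      then have "partial_transfer R U = (\<lambda>x. partial_transfer R {m} (partial_transfer R (U - {m}) x))"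
        by auto
      moreover have "refl R"
        using po by (simp add: order_on_defs)
      ultimately show ?thesis
        using volume_preserving_comp [OF volume_preserving_partial_transfer_single IH] by metis
    qed
  qed
qed

lemma partial_transfer_order_polytope:
  fixes R :: "'n::finite rel"
  assumes po: "partial_order_on UNIV R"
  shows "partial_transfer R UNIV ` order_polytope R = chain_region R 1"
proof (intro equalityI subsetI)
  have refl: "refl R"
    using po by (simp add: order_on_defs)
  fix y assume "y \<in> partial_transfer R UNIV ` order_polytope R"
  then obtain x where x: "x \<in> order_polytope R" and y: "\<And>i. y $ i = x $ i - lower_max R x i"
    by (auto simp: partial_transfer_def)
  have nonneg: "0 \<le> y $ i" for i
    using x lower_max_le [OF refl, of "x $ i" i x] by (auto simp: y order_polytope_def)
  \<comment> \<open>The sum telescopes: without its top \<open>m\<close> the chain weighs at most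
    \<open>x $ k\<close> for its next element \<open>k\<close>, hence at most
    \<open>lower_max R x m\<close>, which is exactly what \<open>y $ m\<close> lacks to reach
    \<open>x $ m\<close>.\<close>
  have chain: "(\<Sum>c\<in>C. y $ c) \<le> x $ m"
    if "C \<in> Chains R" "m \<in> C" "\<And>c. c \<in> C \<Longrightarrow> (c, m) \<in> R" for C m
  proof -
    have "finite C" by simp
    then show ?thesis
      using that
    proof (induction C arbitrary: m rule: finite_psubset_induct)
      case (psubset C)
      have split: "(\<Sum>c\<in>C. y $ c) = y $ m + (\<Sum>c\<in>C - {m}. y $ c)"
        using psubset.prems(2) by (simp add: sum.remove)
      show ?case
      proof (cases "C - {m} = {}")
        case True
        then have "(\<Sum>c\<in>C - {m}. y $ c) = 0"
          by (simp only: sum.empty)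
        then show ?thesis
          using split lower_max_nonneg [OF refl, of x m] by (simp add: y)
      next
        case False
        have C: "C - {m} \<in> Chains R"
          using psubset.prems(1) by (auto simp: Chains_def)
        from chain_has_greatest [OF po this False] obtain k
          where k: "k \<in> C - {m}" "\<And>c. c \<in> C - {m} \<Longrightarrow> (c, k) \<in> R" by blast
        have "(\<Sum>c\<in>C - {m}. y $ c) \<le> x $ k"
          using psubset.prems(2) by (intro psubset.IH C k) auto
        also have "\<dots> \<le> lower_max R x m"
          using k psubset.prems(3) by (intro le_lower_max) auto
        finally show ?thesis
          using split by (simp add: y)
      qed
    qed
  qed
  have "(\<Sum>c\<in>C. y $ c) \<le> 1" if "C \<in> Chains R" for C
  proof (cases "C = {}")
    case False
    with chain_has_greatest [OF po that] obtain m
      where m: "m \<in> C" "\<And>c. c \<in> C \<Longrightarrow> (c, m) \<in> R" by blast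
    have "x $ m \<le> 1"
      using x by (simp add: order_polytope_def)
    with chain [OF that m] show ?thesis by simp
  qed simp
  with nonneg show "y \<in> chain_region R 1"
    by (simp add: chain_region_def)
next
  have refl: "refl R" and trans: "trans R" and antisym: "antisym R"
    using po by (auto simp: order_on_defs)
  fix y assume y: "y \<in> chain_region R 1"
  define K where "K i = {C \<in> Chains R. \<forall>c\<in>C. (c, i) \<in> R}" for i
  \<comment> \<open>The inverse of Stanley's transfer map: the heaviest chain below \<open>i\<close>.\<close>
  define x :: "real ^ 'n" where "x = (\<chi> i. MAX C\<in>K i. \<Sum>c\<in>C. y $ c)"
  have x_ge: "(\<Sum>c\<in>C. y $ c) \<le> x $ i" if "C \<in> K i" for C i
    using that by (simp add: x_def)
  have K_empty: "{} \<in> K i" for i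
    by (simp add: K_def Chains_def)
  have x_attained: "\<exists>C\<in>K i. x $ i = (\<Sum>c\<in>C. y $ c)" for i
  proof -
    have "x $ i \<in> (\<lambda>C. \<Sum>c\<in>C. y $ c) ` K i"
      unfolding x_def vec_lambda_beta using K_empty [of i] by (intro Max_in) auto
    then show ?thesis by auto
  qed
  have x_nonneg: "0 \<le> x $ i" for i
    using x_ge [OF K_empty] by simp
  have mono: "x $ i \<le> x $ j" if "(i, j) \<in> R" for i j
  proof -
    from x_attained obtain C where C: "C \<in> K i" "x $ i = (\<Sum>c\<in>C. y $ c)" by blast
    have "C \<in> K j"
      using C(1) that trans by (auto simp: K_def dest: transD)
    with C(2) x_ge show ?thesis by simp
  qed
  have "x $ i \<le> 1" for i
    using x_attained [of i] y by (auto simp: K_def chain_region_def)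
  with x_nonneg mono have "x \<in> order_polytope R"
    by (auto simp: order_polytope_def)
  \<comment> \<open>Adding \<open>i\<close> to a heaviest chain below some \<open>j\<close> gives
    the upper bound; removing \<open>i\<close> from a heaviest chain below \<open>i\<close> shows
    that the bound is attained.\<close>
  moreover have "lower_max R x i = x $ i - y $ i" for i
  proof (rule lower_max_eqI [OF refl])
    have "{i} \<in> K i"
      using refl by (auto simp: K_def Chains_def refl_on_def)
    from x_ge [OF this] show "0 \<le> x $ i - y $ i" by simp
    show upper: "x $ j \<le> x $ i - y $ i" if "(j, i) \<in> R" "j \<noteq> i" for j
    proof -
      from x_attained obtain C where C: "C \<in> K j" "x $ j = (\<Sum>c\<in>C. y $ c)" by blast
      have i: "i \<notin> C"
        using C(1) that antisym by (auto simp: K_def dest: antisymD)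
      have "insert i C \<in> K i"
        using C(1) that trans refl by (auto simp: K_def Chains_def refl_on_def dest: transD)
      from x_ge [OF this] i C(2) show ?thesis by simp
    qed
    from x_attained obtain C where C: "C \<in> K i" "x $ i = (\<Sum>c\<in>C. y $ c)" by blast
    have CK: "insert i C \<in> K i"
      using C(1) refl by (auto simp: K_def Chains_def refl_on_def)
    \<comment> \<open>As \<open>y\<close> is nonnegative, inserting \<open>i\<close> loses no
      weight, so the heaviest chain may be taken to contain \<open>i\<close>.\<close>
    have "x $ i \<le> (\<Sum>c\<in>insert i C. y $ c)"
      unfolding C(2) using y by (intro sum_mono2) (auto simp: chain_region_def)
    also have "\<dots> = y $ i + (\<Sum>c\<in>C - {i}. y $ c)"
      by (simp add: sum.insert_remove)
    finally have le: "x $ i - y $ i \<le> (\<Sum>c\<in>C - {i}. y $ c)" by simp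
    show "x $ i - y $ i = 0 \<or> (\<exists>j. (j, i) \<in> R \<and> j \<noteq> i \<and> x $ j = x $ i - y $ i)"
    proof (cases "C - {i} = {}")
      case True
      with le \<open>0 \<le> x $ i - y $ i\<close> show ?thesis by (simp del: Diff_eq_empty_iff)
    next
      case False
      have "C - {i} \<in> Chains R"
        using C(1) by (auto simp: K_def Chains_def)
      from chain_has_greatest [OF po this False] obtain k
        where k: "k \<in> C - {i}" "\<And>c. c \<in> C - {i} \<Longrightarrow> (c, k) \<in> R" by blast
      have "C - {i} \<in> K k"
        using C(1) k by (auto simp: K_def Chains_def)
      then have "x $ i - y $ i \<le> x $ k"
        using le x_ge by fastforce
      moreover have "(k, i) \<in> R" "k \<noteq> i"
        using C(1) k(1) by (auto simp: K_def)
      ultimately show ?thesis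
        using upper [of k] by force
    qed
  qed
  then have "y = partial_transfer R UNIV x"
    by (simp add: partial_transfer_def vec_eq_iff)
  ultimately show "y \<in> partial_transfer R UNIV ` order_polytope R" by blast
qed

lemma
  fixes R :: "'n::finite rel"
  assumes po: "partial_order_on UNIV R"
  shows lmeasurable_chain_region: "chain_region R 1 \<in> lmeasurable"
    and measure_chain_region:
      "measure lebesgue (chain_region R 1) = real (num_linear_extensions R) / fact CARD('n)"
proof -
  have "volume_preserving (partial_transfer R UNIV)"
    by (intro volume_preserving_partial_transfer po) auto
  then show "chain_region R 1 \<in> lmeasurable"
    "measure lebesgue (chain_region R 1) = real (num_linear_extensions R) / fact CARD('n)"
    using lmeasurable_order_polytope [of R] measure_order_polytope [of R]
    unfolding volume_preserving_def partial_transfer_order_polytope [OF po, symmetric] by auto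
qed

section \<open>The polytope $\Gamma$\<close>

lemma indicator_vec_nth: "indicator_vec I $ i = (if i \<in> I then 1 else 0)"
  by (simp add: indicator_vec_def axis_def sum.delta)

lemma zero_in_chain_polytope: "0 \<in> chain_polytope P"
proof -
  have "indicator_vec {} \<in> chain_polytope P"
    unfolding chain_polytope_def by (intro hull_inc) (auto simp: antichain_def)
  then show ?thesis
    by (simp add: indicator_vec_def)
qed

lemma card_chain_Int_antichain_le_1:
  assumes "C \<in> Chains P" "antichain P A"
  shows "card (C \<inter> A) \<le> 1"
proof -
  have "x = y" if "x \<in> C \<inter> A" "y \<in> C \<inter> A" for x y
    using assms that unfolding Chains_def antichain_def by blast
  then have "C \<inter> A = {} \<or> (\<exists>z. C \<inter> A = {z})" by blast
  then show ?thesis by auto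
qed

text \<open>
  A vector in the region is decomposed greedily: subtracting the indicator vector of the minimal
  elements of the support, scaled as far as positivity allows, lowers the weight of every
  heaviest chain by the same amount and shrinks the support.
\<close>

lemma chain_region_imp_chain_polytope:
  fixes P :: "'n::finite rel"
  assumes po: "partial_order_on UNIV P" and "y \<in> chain_region P h"
  shows "\<exists>k\<in>chain_polytope P. y = h *\<^sub>R k"
  using assms(2)
proof (induction "card {i. y $ i \<noteq> 0}" arbitrary: y h rule: less_induct)
  case less
  then have nonneg: "\<And>i. 0 \<le> y $ i"
    and chains: "\<And>C. C \<in> Chains P \<Longrightarrow> (\<Sum>i\<in>C. y $ i) \<le> h"
    by (auto simp: chain_region_def)
  define S where "S = {i. y $ i \<noteq> 0}"
  define A where "A = {i \<in> S. \<forall>j\<in>S. (j, i) \<in> P \<longrightarrow> j = i}"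
  have refl: "refl P" and trans: "trans P"
    using po by (auto simp: order_on_defs)
  have A: "antichain P A"
    by (auto simp: antichain_def A_def)
  show ?case
  proof (cases "S = {}")
    case True
    then have "y = h *\<^sub>R 0"
      by (auto simp: S_def vec_eq_iff)
    then show ?thesis
      using zero_in_chain_polytope by blast
  next
    case False
    then obtain c where "c \<in> S" by auto
    from exists_minimal_below [OF po this] have "A \<noteq> {}"
      by (auto simp: A_def)
    \<comment> \<open>The largest multiple of \<open>indicator_vec A\<close> that can be subtracted
      without negative coordinates; it annihilates coordinate \<open>a\<close>, so the support
      shrinks.\<close>
    define e where "e = (MIN i\<in>A. y $ i)"
    have e_le: "e \<le> y $ i" if "i \<in> A" for i
      using that by (simp add: e_def)
    obtain a where a: "a \<in> A" "e = y $ a"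
    proof -
      have "e \<in> (\<lambda>i. y $ i) ` A"
        unfolding e_def using \<open>A \<noteq> {}\<close> by (intro Min_in) auto
      with that show ?thesis by auto
    qed
    have "0 < e"
      using a nonneg [of a] by (auto simp: A_def S_def)
    define y' where "y' = y - e *\<^sub>R indicator_vec A"
    have y': "y' $ i = (if i \<in> A then y $ i - e else y $ i)" for i
      by (simp add: y'_def indicator_vec_nth)
    have "{i. y' $ i \<noteq> 0} \<subset> {i. y $ i \<noteq> 0}"
    proof
      show "{i. y' $ i \<noteq> 0} \<subseteq> {i. y $ i \<noteq> 0}"
        by (auto simp: y' A_def S_def split: if_splits)
      show "{i. y' $ i \<noteq> 0} \<noteq> {i. y $ i \<noteq> 0}"
        using a \<open>0 < e\<close> y' [of a] by (metis (mono_tags, lifting) diff_self less_irrefl mem_Collect_eq)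
    qed
    then have smaller: "card {i. y' $ i \<noteq> 0} < card {i. y $ i \<noteq> 0}"
      by (intro psubset_card_mono) auto
    have chains': "(\<Sum>i\<in>C. y' $ i) \<le> h - e" if C: "C \<in> Chains P" for C
    proof -
      have le: "y' $ i \<le> y $ i" for i
        using \<open>0 < e\<close> by (simp add: y')
      show ?thesis
      proof (cases "C \<inter> A = {}")
        case False
        then obtain b where b: "b \<in> C" "b \<in> A" by auto
        have "(\<Sum>i\<in>C. y' $ i) = (y $ b - e) + (\<Sum>i\<in>C - {b}. y' $ i)"
          using b by (simp add: sum.remove y')
        also have "\<dots> \<le> (y $ b - e) + (\<Sum>i\<in>C - {b}. y $ i)"
          using le by (intro add_left_mono sum_mono)
        also have "\<dots> = (\<Sum>i\<in>C. y $ i) - e"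
          using b by (simp add: sum.remove)
        finally show ?thesis
          using chains [OF C] by simp
      next
        case True
        \<comment> \<open>A chain avoiding \<open>A\<close> has slack: its part in the support
          extends downwards by some \<open>b\<close> in \<open>A\<close>, and the longer chain,
          heavier by at least \<open>e\<close>, still weighs at most \<open>h\<close>.\<close>
        obtain b where b: "b \<in> A" "insert b (C \<inter> S) \<in> Chains P"
        proof (cases "C \<inter> S = {}")
          case True
          have "insert a (C \<inter> S) \<in> Chains P"
            using True refl by (simp add: Chains_def refl_on_def)
          with a that show ?thesis by blast
        next
          case False
          have CS: "C \<inter> S \<in> Chains P"
            using C by (auto simp: Chains_def)
          from chain_has_least [OF po CS False] obtain m
            where m: "m \<in> C \<inter> S" "\<And>c. c \<in> C \<inter> S \<Longrightarrow> (m, c) \<in> P" by blast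
          then have "m \<in> S" by simp
          from exists_minimal_below [OF po this] obtain b where b: "b \<in> A" "(b, m) \<in> P"
            by (auto simp: A_def)
          then have "(b, c) \<in> P" if "c \<in> C \<inter> S" for c
            using m(2) [OF that] trans by (blast dest: transD)
          with CS refl have "insert b (C \<inter> S) \<in> Chains P"
            by (auto simp: Chains_def refl_on_def)
          with b(1) that show ?thesis by blast
        qed
        have "(\<Sum>i\<in>C. y' $ i) \<le> (\<Sum>i\<in>C. y $ i)"
          using le by (intro sum_mono)
        also have "\<dots> = (\<Sum>i\<in>C \<inter> S. y $ i)"
          by (intro sum.mono_neutral_right) (auto simp: S_def)
        also have "\<dots> = (\<Sum>i\<in>insert b (C \<inter> S). y $ i) - y $ b"
          using b(1) True by (subst sum.insert) auto
        also have "\<dots> \<le> h - e"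
          using chains [OF b(2)] e_le [OF b(1)] by simp
        finally show ?thesis .
      qed
    qed
    have "y' \<in> chain_region P (h - e)"
      using nonneg e_le chains' by (auto simp: chain_region_def y')
    from less.hyps [OF smaller this] obtain k where k: "k \<in> chain_polytope P" "y' = (h - e) *\<^sub>R k"
      by blast
    \<comment> \<open>The empty chain gives \<open>e \<le> h\<close>. With \<open>0 < e\<close> this
      makes \<open>h\<close> positive and the two coefficients below convex weights.\<close>
    have "{} \<in> Chains P"
      by (simp add: Chains_def)
    from chains' [OF this] have "e \<le> h" by simp
    have "indicator_vec A \<in> chain_polytope P"
      unfolding chain_polytope_def using A by (intro hull_inc) auto
    moreover have "convex (chain_polytope P)"
      by (simp add: chain_polytope_def)
    ultimately have "((h - e) / h) *\<^sub>R k + (e / h) *\<^sub>R indicator_vec A \<in> chain_polytope P"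
      using k(1) \<open>0 < e\<close> \<open>e \<le> h\<close> by (intro convexD) (auto simp: field_simps)
    moreover have "y = y' + e *\<^sub>R indicator_vec A"
      by (simp add: y'_def)
    then have "y = h *\<^sub>R (((h - e) / h) *\<^sub>R k + (e / h) *\<^sub>R indicator_vec A)"
      using \<open>0 < e\<close> \<open>e \<le> h\<close> by (simp add: k(2) scaleR_add_right)
    ultimately show ?thesis by blast
  qed
qed

section \<open>Chain inequalities for \<open>Gamma_polytope\<close>\<close>

definition signed_chain_region :: "'n::finite rel \<Rightarrow> 'n rel \<Rightarrow> (real ^ 'n) set" where
  "signed_chain_region P Q =
    {x. \<forall>C\<in>Chains P. \<forall>D\<in>Chains Q. (\<Sum>i\<in>C. max 0 (x $ i)) + (\<Sum>i\<in>D. max 0 (- x $ i)) \<le> 1}"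

text \<open>Each left-hand side is a sum of sublinear functions of \<open>x\<close>, because
  \<open>max 0\<close> is sublinear, and the region is an intersection of their sublevel
  sets.\<close>

lemma convex_signed_chain_region:
  fixes P Q :: "'n::finite rel"
  shows "convex (signed_chain_region P Q)"
proof -
  let ?f = "\<lambda>C D (x :: real ^ 'n). (\<Sum>i\<in>C. max 0 (x $ i)) + (\<Sum>i\<in>D. max 0 (- x $ i))"
  have max: "max 0 (u * a + v * b) \<le> u * max 0 a + v * max 0 b" if "0 \<le> u" "0 \<le> v" for u v a b :: real
    using that by (simp add: add_mono mult_left_mono)
  have conv: "?f C D (u *\<^sub>R x + v *\<^sub>R y) \<le> u * ?f C D x + v * ?f C D y"
    if "0 \<le> u" "0 \<le> v" for C D u v x y
  proof -
    have "?f C D (u *\<^sub>R x + v *\<^sub>R y) \<le>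
        (\<Sum>i\<in>C. u * max 0 (x $ i) + v * max 0 (y $ i)) +
        (\<Sum>i\<in>D. u * max 0 (- x $ i) + v * max 0 (- y $ i))"
      using max [OF that] max [OF that, of "- x $ i" "- y $ i" for i]
      by (intro add_mono sum_mono) auto
    also have "\<dots> = u * ?f C D x + v * ?f C D y"
      by (simp add: sum.distrib sum_distrib_left algebra_simps)
    finally show ?thesis .
  qed
  show ?thesis
  proof (rule convexI)
    fix x y :: "real ^ 'n" and u v :: real
    assume *: "x \<in> signed_chain_region P Q" "y \<in> signed_chain_region P Q"
      "0 \<le> u" "0 \<le> v" "u + v = 1"
    have "?f C D (u *\<^sub>R x + v *\<^sub>R y) \<le> 1" if "C \<in> Chains P" "D \<in> Chains Q" for C D
    proof -
      have "?f C D x \<le> 1" "?f C D y \<le> 1"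
        using * that by (auto simp: signed_chain_region_def)
      then have "u * ?f C D x + v * ?f C D y \<le> u * 1 + v * 1"
        using * by (intro add_mono mult_left_mono)
      with conv [OF *(3,4), of x y C D] *(5) show ?thesis by simp
    qed
    then show "u *\<^sub>R x + v *\<^sub>R y \<in> signed_chain_region P Q"
      by (simp add: signed_chain_region_def)
  qed
qed

text \<open>By convexity, one inclusion need only be checked on antichain vectors and their
  negatives. For the other, the positive and negative parts of \<open>x\<close> are multiples of
  points of the two chain polytopes, each scaled by its heaviest chain weight.\<close>

lemma Gamma_polytope_eq_signed_chain_region:
  fixes P Q :: "'n::finite rel"
  assumes poP: "partial_order_on UNIV P" and poQ: "partial_order_on UNIV Q"
  shows "Gamma_polytope (chain_polytope P) (uminus ` chain_polytope Q) = signed_chain_region P Q"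
proof
  have sum: "(\<Sum>i\<in>C. max 0 (indicator_vec A $ i)) \<le> 1"
    if "C \<in> Chains R" "antichain R A" for R :: "'n rel" and C A
  proof -
    have "(\<Sum>i\<in>C. max 0 (indicator_vec A $ i)) = (\<Sum>i\<in>C. if i \<in> A then 1 else 0 :: real)"
      by (intro sum.cong) (auto simp: indicator_vec_nth)
    also have "\<dots> = real (card (C \<inter> A))"
      by (simp add: sum.If_cases Int_def)
    finally show ?thesis
      using card_chain_Int_antichain_le_1 [OF that] by simp
  qed
  have zero: "(\<Sum>i\<in>C. max 0 (- indicator_vec A $ i)) = (0::real)" for C A :: "'n set"
    by (auto intro!: sum.neutral simp: indicator_vec_nth)
  have P: "chain_polytope P \<subseteq> signed_chain_region P Q"
    unfolding chain_polytope_def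
    by (intro hull_minimal convex_signed_chain_region)
      (auto simp: signed_chain_region_def sum zero)
  \<comment> \<open>The negation is moved to the other side so that \<open>hull_minimal\<close>
    applies to the hull defining \<open>chain_polytope Q\<close>.\<close>
  have "chain_polytope Q \<subseteq> uminus ` signed_chain_region P Q"
    unfolding chain_polytope_def
  proof (intro hull_minimal convex_negations convex_signed_chain_region subsetI)
    fix v assume "v \<in> {indicator_vec A |A. antichain Q A}"
    then have "- v \<in> signed_chain_region P Q"
      by (auto simp: signed_chain_region_def sum zero)
    then show "v \<in> uminus ` signed_chain_region P Q"
      by (metis image_eqI minus_minus)
  qed
  then have Q: "uminus ` chain_polytope Q \<subseteq> signed_chain_region P Q"
    by auto
  show "Gamma_polytope (chain_polytope P) (uminus ` chain_polytope Q) \<subseteq> signed_chain_region P Q"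
    unfolding Gamma_polytope_def
    by (intro hull_minimal convex_signed_chain_region Un_least P Q)
next
  show "signed_chain_region P Q \<subseteq> Gamma_polytope (chain_polytope P) (uminus ` chain_polytope Q)"
  proof
    fix x assume x: "x \<in> signed_chain_region P Q"
    define p :: "real ^ 'n" where "p = (\<chi> i. max 0 (x $ i))"
    define q :: "real ^ 'n" where "q = (\<chi> i. max 0 (- x $ i))"
    define h where "h R y = (MAX C\<in>Chains R. \<Sum>i\<in>C. y $ i)" for R and y :: "real ^ 'n"
    have empty: "{} \<in> Chains R" for R :: "'n rel"
      by (simp add: Chains_def)
    have h_ge: "(\<Sum>i\<in>C. y $ i) \<le> h R y" if "C \<in> Chains R" for C R y
      using that by (simp add: h_def)
    have h_attained: "\<exists>C\<in>Chains R. h R y = (\<Sum>i\<in>C. y $ i)" for R y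
    proof -
      have "h R y \<in> (\<lambda>C. \<Sum>i\<in>C. y $ i) ` Chains R"
        unfolding h_def using empty [of R] by (intro Max_in) auto
      then show ?thesis by auto
    qed
    have h_nonneg: "0 \<le> h R y" for R y
      using h_ge [OF empty] by simp
    obtain C D where "C \<in> Chains P" "h P p = (\<Sum>i\<in>C. p $ i)" "D \<in> Chains Q" "h Q q = (\<Sum>i\<in>D. q $ i)"
      using h_attained by metis
    with x have le: "h P p + h Q q \<le> 1"
      by (auto simp: signed_chain_region_def p_def q_def)
    have "0 \<le> p $ i" "0 \<le> q $ i" for i
      by (simp_all add: p_def q_def)
    then have "p \<in> chain_region P (h P p)" "q \<in> chain_region Q (h Q q)"
      by (simp_all add: chain_region_def h_ge)
    then obtain k l where k: "k \<in> chain_polytope P" "p = h P p *\<^sub>R k"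
      and l: "l \<in> chain_polytope Q" "q = h Q q *\<^sub>R l"
      using chain_region_imp_chain_polytope poP poQ by blast
    let ?G = "Gamma_polytope (chain_polytope P) (uminus ` chain_polytope Q)"
    have G: "k \<in> ?G" "- l \<in> ?G" "0 \<in> ?G"
      unfolding Gamma_polytope_def
      by (intro hull_inc; use k(1) l(1) zero_in_chain_polytope in blast)+
    have "x = p - q"
      by (auto simp: p_def q_def vec_eq_iff)
    also have "\<dots> = h P p *\<^sub>R k - h Q q *\<^sub>R l"
      using k(2) l(2) by simp
    \<comment> \<open>The two weights may sum to less than 1; the origin takes up the remainder and
      completes a convex combination.\<close>
    also have "\<dots> =
        (\<Sum>i<3. ([h P p, h Q q, 1 - h P p - h Q q] ! i) *\<^sub>R ([k, - l, 0] ! i))"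
      by (simp add: eval_nat_numeral)
    also have "\<dots> \<in> ?G"
    proof (rule convex_sum)
      show "convex ?G"
        by (simp add: Gamma_polytope_def)
    qed (use G le h_nonneg [of P p] h_nonneg [of Q q] in
        \<open>auto simp: eval_nat_numeral less_Suc_eq\<close>)
    finally show "x \<in> ?G" .
  qed
qed

section \<open>Orthants and ordinal sums\<close>

lemma partial_order_on_Delta:
  fixes P Q :: "'n rel"
  assumes "partial_order_on UNIV P" "partial_order_on UNIV Q"
  shows "partial_order_on UNIV (Delta W P Q)"
proof -
  have PQ: "refl P" "antisym P" "trans P" "refl Q" "antisym Q" "trans Q"
    using assms by (auto simp: order_on_defs)
  have iff: "(i, j) \<in> Delta W P Q \<longleftrightarrow>
      (if i \<in> W then j \<in> W \<longrightarrow> (i, j) \<in> P else j \<notin> W \<and> (i, j) \<in> Q)" for i j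
    by (auto simp: Delta_def ordinal_sum_def induced_order_def)
  have "refl (Delta W P Q)"
    using PQ(1,4) by (simp add: refl_on_def iff)
  moreover have "antisym (Delta W P Q)"
    using PQ(2,5) by (auto simp: antisym_def iff split: if_splits)
  moreover have "trans (Delta W P Q)"
  proof (rule transI)
    fix i j k assume "(i, j) \<in> Delta W P Q" "(j, k) \<in> Delta W P Q"
    then show "(i, k) \<in> Delta W P Q"
      using transD [OF PQ(3), of i j k] transD [OF PQ(6), of i j k]
      by (auto simp: iff split: if_splits)
  qed
  ultimately show ?thesis
    by (simp add: order_on_defs)
qed

text \<open>Elements of \<open>W\<close> lie below all others in \<open>Delta W P Q\<close>, so
  comparability across the two parts is automatic.\<close>

lemma Chains_Delta:
  "C \<in> Chains (Delta W P Q) \<longleftrightarrow> C \<inter> W \<in> Chains P \<and> C - W \<in> Chains Q"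
  unfolding Chains_def Delta_def ordinal_sum_def induced_order_def by blast

text \<open>After reflection to a nonnegative \<open>y\<close>, the positive part is
  \<open>y\<close> on \<open>W\<close> and the negative part is \<open>y\<close> off
  \<open>W\<close>. A chain of \<open>P\<close> thus counts only inside \<open>W\<close>, a chain of
  \<open>Q\<close> only outside, and the two remnants form one chain of
  \<open>Delta W P Q\<close>.\<close>

lemma signed_chain_region_orthant:
  fixes P Q :: "'n::finite rel"
  shows "signed_chain_region P Q \<inter> {x. (\<forall>i\<in>W. 0 \<le> x $ i) \<and> (\<forall>i\<in>-W. x $ i \<le> 0)} =
    (\<lambda>x. \<chi> i. if i \<in> W then x $ i else - x $ i) ` chain_region (Delta W P Q) 1"
    (is "_ \<inter> ?O = ?r ` _")
proof -
  have r: "?r (?r x) = x" for x :: "real ^ 'n"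
    by (simp add: vec_eq_iff)
  have iff: "?r y \<in> signed_chain_region P Q \<longleftrightarrow> y \<in> chain_region (Delta W P Q) 1"
    if nonneg: "\<And>i. 0 \<le> y $ i" for y
  proof -
    have max: "max 0 (?r y $ i) = (if i \<in> W then y $ i else 0)"
      "max 0 (- ?r y $ i) = (if i \<in> - W then y $ i else 0)" for i
      by (simp_all add: nonneg)
    have C: "(\<Sum>i\<in>C. max 0 (?r y $ i)) = (\<Sum>i\<in>C \<inter> W. y $ i)" for C
      unfolding max by (simp add: sum.inter_restrict)
    have D: "(\<Sum>i\<in>D. max 0 (- ?r y $ i)) = (\<Sum>i\<in>D - W. y $ i)" for D
      unfolding max Diff_eq by (simp add: sum.inter_restrict)
    have split: "(\<Sum>i\<in>E. y $ i) = (\<Sum>i\<in>E \<inter> W. y $ i) + (\<Sum>i\<in>E - W. y $ i)" for E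
      by (simp add: sum.Int_Diff)
    show ?thesis
    proof
      assume *: "?r y \<in> signed_chain_region P Q"
      have "(\<Sum>i\<in>E. y $ i) \<le> 1" if "E \<in> Chains (Delta W P Q)" for E
      proof -
        from that have "E \<inter> W \<in> Chains P" "E - W \<in> Chains Q"
          by (auto simp: Chains_Delta)
        with * have "(\<Sum>i\<in>E \<inter> W. max 0 (?r y $ i)) + (\<Sum>i\<in>E - W. max 0 (- ?r y $ i)) \<le> 1"
          unfolding signed_chain_region_def by blast
        then show ?thesis
          unfolding C D split [of E] by simp
      qed
      with nonneg show "y \<in> chain_region (Delta W P Q) 1"
        by (simp add: chain_region_def)
    next
      assume *: "y \<in> chain_region (Delta W P Q) 1"
      have "(\<Sum>i\<in>C \<inter> W. y $ i) + (\<Sum>i\<in>D - W. y $ i) \<le> 1" if "C \<in> Chains P" "D \<in> Chains Q" for C D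
      proof -
        let ?E = "(C \<inter> W) \<union> (D - W)"
        have E: "?E \<inter> W = C \<inter> W" "?E - W = D - W" by auto
        have "?E \<in> Chains (Delta W P Q)"
          unfolding Chains_Delta E using that by (auto simp: Chains_def)
        with * have "(\<Sum>i\<in>?E. y $ i) \<le> 1"
          by (simp add: chain_region_def)
        then show ?thesis
          unfolding split [of ?E] E .
      qed
      then show "?r y \<in> signed_chain_region P Q"
        unfolding signed_chain_region_def mem_Collect_eq C D by blast
    qed
  qed
  show ?thesis
  proof (intro equalityI subsetI)
    fix x assume x: "x \<in> signed_chain_region P Q \<inter> ?O"
    then have "0 \<le> ?r x $ i" for i
      by (cases "i \<in> W") auto
    from iff [OF this] x have "?r x \<in> chain_region (Delta W P Q) 1"
      unfolding r by blast
    then show "x \<in> ?r ` chain_region (Delta W P Q) 1"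
      by (rule image_eqI [rotated]) (simp only: r)
  next
    fix x assume "x \<in> ?r ` chain_region (Delta W P Q) 1"
    then obtain y where y: "y \<in> chain_region (Delta W P Q) 1" "x = ?r y" by blast
    then have nonneg: "\<And>i. 0 \<le> y $ i"
      by (simp add: chain_region_def)
    then have "?r y \<in> ?O" by simp
    moreover have "?r y \<in> signed_chain_region P Q"
      using iff [OF nonneg] y(1) by blast
    ultimately show "x \<in> signed_chain_region P Q \<inter> ?O"
      unfolding y(2) by blast
  qed
qed

theorem theorem1p3:
  fixes P Q :: "'n::finite rel"
  assumes "partial_order_on UNIV P" and "partial_order_on UNIV Q"
  shows "measure lebesgue (Gamma_polytope (chain_polytope P) (uminus ` chain_polytope Q)) =
    (\<Sum>W\<in>(UNIV :: 'n set set). real (num_linear_extensions (Delta W P Q)) / fact CARD('n))"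
proof -
  \<comment> \<open>Closed orthants are used, so the pieces overlap, but only in null sets.\<close>
  define B :: "'n set \<Rightarrow> (real ^ 'n) set"
    where "B W = signed_chain_region P Q \<inter> {x. (\<forall>i\<in>W. 0 \<le> x $ i) \<and> (\<forall>i\<in>-W. x $ i \<le> 0)}" for W
  have B: "B W \<in> lmeasurable \<and>
      measure lebesgue (B W) = real (num_linear_extensions (Delta W P Q)) / fact CARD('n)" for W
  proof -
    have po: "partial_order_on UNIV (Delta W P Q)"
      using assms by (rule partial_order_on_Delta)
    show ?thesis
      unfolding B_def signed_chain_region_orthant
      using volume_preserving_reflection [of W, unfolded volume_preserving_def, rule_format,
          OF lmeasurable_chain_region [OF po]]
      by (simp add: measure_chain_region [OF po])
  qed
  have "signed_chain_region P Q = (\<Union>W. B W)"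
  proof (intro equalityI subsetI)
    fix x assume "x \<in> signed_chain_region P Q"
    then have "x \<in> B {i. 0 \<le> x $ i}"
      by (auto simp: B_def)
    then show "x \<in> (\<Union>W. B W)" by blast
  qed (auto simp: B_def)
  then have "measure lebesgue (signed_chain_region P Q) = (\<Sum>W\<in>UNIV. measure lebesgue (B W))"
  proof (simp only:, intro measure_negligible_finite_Union_image)
    show "pairwise (\<lambda>V W. negligible (B V \<inter> B W)) UNIV"
    proof (rule pairwiseI)
      fix V W :: "'n set" assume "V \<noteq> W"
      then obtain i where "i \<in> V \<longleftrightarrow> i \<notin> W" by auto
      \<comment> \<open>Coordinate \<open>i\<close> is nonnegative on one piece and nonpositive on
        the other, hence zero on both.\<close>
      then have "B V \<inter> B W \<subseteq> {x. axis i 1 \<bullet> x = 0}"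
        by (cases "i \<in> V") (auto simp: B_def inner_axis' order_eq_iff)
      moreover have "negligible {x :: real ^ 'n. axis i 1 \<bullet> x = 0}"
        by (intro negligible_hyperplane) (simp add: axis_eq_0_iff)
      ultimately show "negligible (B V \<inter> B W)"
        by (rule negligible_subset [rotated])
    qed
  qed (use B in auto)
  then show ?thesis
    using B by (simp add: Gamma_polytope_eq_signed_chain_region [OF assms])
qed

end
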